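(* For all integers $n\geq 1$, $ac(n)=f_3(n)+f_3(n-2)$.
   Context: A composition of $n$ of length $s$ is a sequence $\sigma=(\sigma_1,\ldots,\sigma_s)$ of positive integers with $\sum_i\sigma_i=n$; the empty composition is the unique composition of $0$. A composition is anti-palindromic if $\sigma_i\neq\sigma_{s-i+1}$ for all $i$ with $i\neq\frac{s+1}{2}$. $ac(n)$ denotes the number of anti-palindromic compositions of $n$. The tribonacci numbers are defined by $f_3(n)=0$ for $n<1$, $f_3(1)=1$, and $f_3(n)=f_3(n-1)+f_3(n-2)+f_3(n-3)$ for $n\geq 2$. *)

theory Defs
  imports Main
begin

definition compositions :: "nat \<Rightarrow> nat list set" where
  "compositions n = {\<sigma>. (\<forall>x\<in>set \<sigma>. 0 < x) \<and> sum_list \<sigma> = n}"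

text \<open>Positions \<open>i\<close> are counted from 1, so the \<open>i\<close>-th part is \<open>\<sigma> ! (i - 1)\<close> and the part at
  position \<open>s - i + 1\<close> is \<open>\<sigma> ! (s - i)\<close>. The condition \<open>2 * i \<noteq> s + 1\<close> exempts the middle
  position, which exists only for odd \<open>s\<close>.\<close>

definition antipalindromic :: "nat list \<Rightarrow> bool" where
  "antipalindromic \<sigma> \<longleftrightarrow>
    (\<forall>i\<in>{1..length \<sigma>}. 2 * i \<noteq> length \<sigma> + 1 \<longrightarrow> \<sigma> ! (i - 1) \<noteq> \<sigma> ! (length \<sigma> - i))"

definition ac :: "nat \<Rightarrow> nat" where
  "ac n = card {\<sigma> \<in> compositions n. antipalindromic \<sigma>}"

text \<open>The cardinality in \<open>ac\<close> is that of a finite set.\<close>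

lemma finite_compositions: "finite (compositions n)"
proof (rule finite_subset)
  have len: "length \<sigma> \<le> sum_list \<sigma>" if "\<forall>x\<in>set \<sigma>. 0 < x" for \<sigma> :: "nat list"
    using that by (induction \<sigma>) auto
  show "compositions n \<subseteq> {\<sigma>. set \<sigma> \<subseteq> {..n} \<and> length \<sigma> \<le> n}"
    using len by (auto simp: compositions_def intro: member_le_sum_list)
  show "finite {\<sigma>. set \<sigma> \<subseteq> {..n} \<and> length \<sigma> \<le> n}"
    by (rule finite_lists_length_le) simp
qed

function f3 :: "int \<Rightarrow> nat" where
  "n < 1 \<Longrightarrow> f3 n = 0"
| "f3 1 = 1"
| "n \<ge> 2 \<Longrightarrow> f3 n = f3 (n - 1) + f3 (n - 2) + f3 (n - 3)"
  by atomize_elim auto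
termination by (relation "measure nat") auto

end

theory Submission
  imports Defs
begin

text \<open>An anti-palindromic composition with at least two parts consists of outer parts
  \<open>a \<noteq> b\<close> around an anti-palindromic composition \<open>m\<close>. If neither outer part is 1, subtracting 1
  from both reduces the total by 2. If \<open>a = 1\<close>, then either \<open>b = 2\<close>, and \<open>m\<close> is an
  arbitrary anti-palindromic composition of \<open>n - 3\<close>, or subtracting 1 from \<open>b\<close> reduces the
  total by 1; likewise if \<open>b = 1\<close>. Counting these cases shows that \<open>ac\<close> satisfies
  the tribonacci recurrence from \<open>n = 3\<close> on.\<close>

definition ap_compositions :: "nat \<Rightarrow> nat list set" where
  "ap_compositions n = {\<sigma> \<in> compositions n. antipalindromic \<sigma>}"

text \<open>The triples encode the compositions \<open>a # m @ [b]\<close>. The guard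
  \<open>a + b \<le> n\<close> is required because subtraction on \<open>nat\<close>
  truncates.\<close>

definition wrapped :: "nat \<Rightarrow> (nat \<times> nat \<times> nat list) set" where
  "wrapped n = {(a, b, m). 0 < a \<and> 0 < b \<and> a \<noteq> b \<and> a + b \<le> n \<and> m \<in> ap_compositions (n - a - b)}"

definition wrapped1 :: "nat \<Rightarrow> (nat \<times> nat list) set" where
  "wrapped1 n = {(b, m). (1, b, m) \<in> wrapped n}"

lemma finite_ap_compositions: "finite (ap_compositions n)"
  by (simp add: ap_compositions_def finite_compositions)

lemma finite_wrapped: "finite (wrapped n)"
proof (rule finite_subset)
  show "wrapped n \<subseteq> {..n} \<times> {..n} \<times> (\<Union>k\<le>n. ap_compositions k)"
    by (auto simp: wrapped_def intro!: bexI[of _ "n - _"])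
qed (simp add: finite_ap_compositions)

lemma finite_wrapped1: "finite (wrapped1 n)"
proof (rule finite_subset)
  show "wrapped1 n \<subseteq> snd ` wrapped n"
    by (force simp: wrapped1_def)
qed (simp add: finite_wrapped)

text \<open>Shifting the index by one gives 0-based positions, the form that fits list
  recursion.\<close>

lemma antipalindromic_iff:
  "antipalindromic \<sigma> \<longleftrightarrow>
    (\<forall>i<length \<sigma>. 2 * i + 1 \<noteq> length \<sigma> \<longrightarrow> \<sigma> ! i \<noteq> \<sigma> ! (length \<sigma> - Suc i))"
proof -
  have "{1..length \<sigma>} = Suc ` {..<length \<sigma>}"
    by (simp add: lessThan_atLeast0 image_Suc_atLeastLessThan atLeastLessThanSuc_atLeastAtMost)
  then show ?thesis
    by (auto simp: antipalindromic_def)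
qed

text \<open>The two outer positions mirror each other. Inner positions move by 1 while the length
  grows by 2, so mirror pairs and the middle of \<open>m\<close> are preserved.\<close>

lemma antipalindromic_wrap:
  "antipalindromic (a # m @ [b]) \<longleftrightarrow> a \<noteq> b \<and> antipalindromic m"
proof -
  have split: "(\<forall>i<Suc (Suc k). P i) \<longleftrightarrow> P 0 \<and> P (Suc k) \<and> (\<forall>i<k. P (Suc i))" for k P
    unfolding All_less_Suc2[of "Suc k"] by (auto simp: less_Suc_eq)
  \<comment> \<open>The mirror of the inner position \<open>Suc i\<close> is
    \<open>length m - i\<close>, which is at least 1 and thus falls inside \<open>m\<close>.\<close>
  have nth: "(a # m @ [b]) ! (length m - i) = m ! (length m - Suc i)" if "i < length m" for i
    using that by (auto simp: nth_Cons' nth_append)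
  have "antipalindromic (a # m @ [b]) \<longleftrightarrow> a \<noteq> b \<and> b \<noteq> a \<and>
      (\<forall>i<length m. 2 * i + 1 \<noteq> length m \<longrightarrow> (m @ [b]) ! i \<noteq> (a # m @ [b]) ! (length m - i))"
    unfolding antipalindromic_iff length_Cons length_append list.size add_0_right add_Suc_right split
    by simp
  also have "\<dots> \<longleftrightarrow> a \<noteq> b \<and> antipalindromic m"
    by (auto simp: antipalindromic_iff nth nth_append)
  finally show ?thesis .
qed

lemma ap_compositions_eq:
  "ap_compositions n =
    insert (if n = 0 then [] else [n]) ((\<lambda>(a, b, m). a # m @ [b]) ` wrapped n)"
    (is "_ = ?R")
proof (intro equalityI subsetI)
  fix \<sigma> assume \<sigma>: "\<sigma> \<in> ap_compositions n"
  show "\<sigma> \<in> ?R"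
  proof (cases \<sigma>)
    case Nil
    with \<sigma> show ?thesis by (simp add: ap_compositions_def compositions_def)
  next
    case (Cons a \<tau>)
    show ?thesis
    proof (cases \<tau> rule: rev_cases)
      case Nil
      with \<sigma> Cons show ?thesis by (auto simp: ap_compositions_def compositions_def)
    next
      case (snoc m b)
      with \<sigma> Cons have "(a, b, m) \<in> wrapped n"
        by (auto simp: ap_compositions_def compositions_def wrapped_def antipalindromic_wrap)
      with Cons snoc show ?thesis by force
    qed
  qed
next
  fix \<sigma> assume "\<sigma> \<in> ?R"
  then show "\<sigma> \<in> ap_compositions n"
    by (auto simp: ap_compositions_def compositions_def wrapped_def antipalindromic_wrap
        antipalindromic_iff[of "[]"] antipalindromic_iff[of "[n]"] split: if_splits)
qed

text \<open>The successor counts the only composition with fewer than two parts, \<open>[]\<close>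
  or \<open>[n]\<close>.\<close>

lemma ac_eq_wrapped: "ac n = Suc (card (wrapped n))"
proof -
  have "inj_on (\<lambda>(a, b, m). a # m @ [b]) (wrapped n)"
    by (auto simp: inj_on_def)
  moreover have "(if n = 0 then [] else [n]) \<notin> (\<lambda>(a, b, m). a # m @ [b]) ` wrapped n"
    by auto
  ultimately show ?thesis
    unfolding ac_def ap_compositions_def[symmetric] ap_compositions_eq
    by (simp add: finite_wrapped card_image)
qed

lemma wrapped_swap: "(a, b, m) \<in> wrapped n \<longleftrightarrow> (b, a, m) \<in> wrapped n"
  by (auto simp: wrapped_def diff_commute add.commute)

lemma wrapped_Suc_Suc:
  "wrapped (Suc (Suc n)) = (\<lambda>(a, b, m). (Suc a, Suc b, m)) ` wrapped n
     \<union> Pair 1 ` wrapped1 (Suc (Suc n)) \<union> (\<lambda>(a, m). (a, 1, m)) ` wrapped1 (Suc (Suc n))"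
    (is "?L = ?S \<union> ?A \<union> ?B")
proof (intro equalityI subsetI)
  fix t assume t: "t \<in> ?L"
  obtain a b m where abm: "t = (a, b, m)" by (cases t)
  consider "a = 1" | "b = 1" | a' b' where "a = Suc a'" "b = Suc b'" "0 < a'" "0 < b'"
    using t abm by (cases a; cases b) (auto simp: wrapped_def)
  then show "t \<in> ?S \<union> ?A \<union> ?B"
  proof cases
    case 1
    with t abm show ?thesis by (simp add: wrapped1_def)
  next
    case 2
    with t abm have "(a, m) \<in> wrapped1 (Suc (Suc n))"
      by (simp add: wrapped1_def wrapped_swap[of "Suc 0"])
    with 2 abm show ?thesis by force
  next
    case 3
    with t abm have "(a', b', m) \<in> wrapped n"
      by (auto simp: wrapped_def)
    with 3 abm show ?thesis by force
  qed
next
  fix t assume "t \<in> ?S \<union> ?A \<union> ?B"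
  then consider "t \<in> ?S" | "t \<in> ?A" | "t \<in> ?B" by blast
  then show "t \<in> ?L"
  proof cases
    case 1
    then show ?thesis by (auto simp: wrapped_def)
  next
    case 2
    then show ?thesis by (auto simp: wrapped1_def)
  next
    case 3
    then show ?thesis by (auto simp: wrapped1_def wrapped_swap[of _ "Suc 0"])
  qed
qed

lemma card_wrapped_Suc_Suc:
  "card (wrapped (Suc (Suc n))) = card (wrapped n) + 2 * card (wrapped1 (Suc (Suc n)))"
proof -
  let ?S = "(\<lambda>(a, b, m). (Suc a, Suc b, m)) ` wrapped n"
  let ?A = "Pair (1::nat) ` wrapped1 (Suc (Suc n))"
  let ?B = "(\<lambda>(a, m). (a, 1::nat, m)) ` wrapped1 (Suc (Suc n))"
  \<comment> \<open>Outer parts in \<open>?S\<close> are at least 2, and a common element of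
    \<open>?A\<close> and \<open>?B\<close> would have both outer parts equal to 1.\<close>
  have "?S \<inter> ?A = {}" "(?S \<union> ?A) \<inter> ?B = {}"
    by (auto simp: wrapped_def wrapped1_def)
  then have "card (wrapped (Suc (Suc n))) = card ?S + card ?A + card ?B"
    unfolding wrapped_Suc_Suc
    by (simp add: card_Un_disjoint finite_wrapped finite_wrapped1 del: One_nat_def)
  moreover have "card ?S = card (wrapped n)"
    by (rule card_image) (auto simp: inj_on_def)
  moreover have "card ?A = card (wrapped1 (Suc (Suc n)))"
    by (rule card_image) (auto simp: inj_on_def)
  moreover have "card ?B = card (wrapped1 (Suc (Suc n)))"
    by (rule card_image) (auto simp: inj_on_def)
  ultimately show ?thesis by simp
qed

text \<open>Next to a first part 1, the last part is at least 2, and 2 is the only value whose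
  decrement would make the outer parts equal.\<close>

lemma wrapped1_Suc:
  "wrapped1 (n + 3) = Pair 2 ` ap_compositions n \<union> map_prod Suc id ` wrapped1 (n + 2)"
    (is "?L = ?T \<union> ?S")
proof (intro equalityI subsetI)
  fix t assume t: "t \<in> ?L"
  obtain b m where bm: "t = (b, m)" by (cases t)
  show "t \<in> ?T \<union> ?S"
  proof (cases "b = 2")
    case True
    with t bm show ?thesis by (simp add: wrapped1_def wrapped_def)
  next
    case False
    with t bm obtain b' where b': "b = Suc b'" "(b', m) \<in> wrapped1 (n + 2)"
      by (cases b) (auto simp: wrapped1_def wrapped_def)
    with bm show ?thesis by (auto simp: map_prod_def intro!: image_eqI)
  qed
next
  fix t assume "t \<in> ?T \<union> ?S"
  then show "t \<in> ?L" by (auto simp: wrapped1_def wrapped_def)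
qed

lemma card_wrapped1_Suc:
  "card (wrapped1 (n + 3)) = ac n + card (wrapped1 (n + 2))"
proof -
  have "Pair 2 ` ap_compositions n \<inter> map_prod Suc id ` wrapped1 (n + 2) = {}"
    by (auto simp: wrapped1_def wrapped_def)
  then have "card (wrapped1 (n + 3)) =
      card (Pair (2::nat) ` ap_compositions n) + card (map_prod Suc id ` wrapped1 (n + 2))"
    unfolding wrapped1_Suc
    by (simp add: card_Un_disjoint finite_ap_compositions finite_wrapped1)
  moreover have "card (Pair (2::nat) ` ap_compositions n) = ac n"
    by (simp add: card_image inj_on_def ac_def ap_compositions_def)
  moreover have "card (map_prod Suc id ` wrapped1 (n + 2)) = card (wrapped1 (n + 2))"
    by (rule card_image) (auto simp: inj_on_def)
  ultimately show ?thesis by simp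
qed

text \<open>With w(k) for \<open>card (wrapped1 k)\<close>, ac(n+3) = ac(n+1) + 2 w(n+3) and ac(n+2)
  = ac(n) + 2 w(n+2). Subtracting and using w(n+3) - w(n+2) = ac(n) eliminates w.\<close>

lemma ac_rec: "ac (n + 3) = ac (n + 2) + ac (n + 1) + ac n"
  using card_wrapped_Suc_Suc[of "n + 1"] card_wrapped_Suc_Suc[of n] card_wrapped1_Suc[of n]
  by (simp add: ac_eq_wrapped eval_nat_numeral)

text \<open>Two distinct positive outer parts already sum to at least 3.\<close>

lemma ac_le_2: "n \<le> 2 \<Longrightarrow> ac n = 1"
proof -
  assume "n \<le> 2"
  then have "wrapped n = {}" by (auto simp: wrapped_def)
  then show ?thesis by (simp add: ac_eq_wrapped)
qed

theorem theorem2: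
  fixes n :: nat
  assumes "n \<ge> 1"
  shows "ac n = f3 (int n) + f3 (int n - 2)"
  using assms
proof (induction n rule: less_induct)
  case (less n)
  \<comment> \<open>The case \<open>n = 3\<close> stands apart: \<open>f3 1\<close> is an initial
    value outside the recurrence, and the formula fails at 0, where \<open>ac 0 = 1\<close> but both
    \<open>f3\<close> terms vanish.\<close>
  consider "n = 1" | "n = 2" | "n = 3" | "n \<ge> 4"
    using less.prems by linarith
  then show ?case
  proof cases
    case 4
    then have "n - 3 + 3 = n" "n - 3 + 2 = n - 1" "n - 3 + 1 = n - 2"
      by linarith+
    with ac_rec[of "n - 3"] have "ac n = ac (n - 1) + ac (n - 2) + ac (n - 3)"
      by (simp only:)
    with 4 less.IH[of "n - 1"] less.IH[of "n - 2"] less.IH[of "n - 3"] show ?thesis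
      by (simp add: f3.simps(3)[of "int n"] f3.simps(3)[of "int n - 2"] of_nat_diff)
  qed (use ac_rec[of 0] in \<open>simp_all add: ac_le_2\<close>)
qed

end
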